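(* For every integer $w \ge 1$ there is a constant $m_0(w)$ with the following property: for all integers $m \ge m_0(w)$ and all positive integers $n$, if $|\mathcal{B}(n,w)| \ge 2^m$, then an $(m,n,w)$-domination mapping exists.
   Context: For $y \in \{0,1\}^n$, $\mathrm{wt}(y)$ is the number of nonzero coordinates of $y$, and $\mathcal{B}(n,w)=\{y\in\{0,1\}^n : \mathrm{wt}(y)\le w\}$. A domination graph is a bipartite graph $G=([m]\cup[n],E)$ with left vertex set $[m]$ and right vertex set $[n]$ (disjoint copies) having no isolated right vertices. Given $G$, an injective map $\varphi:\{0,1\}^m\to\mathcal{B}(n,w)$ is $G$-dominating if for every $x\in\{0,1\}^m$ and every edge $(i,j)\in E$ ($i\in[m]$, $j\in[n]$): if $x_i=0$ then the $j$-th coordinate of $\varphi(x)$ is $0$. An $(m,n,w)$-domination mapping is an injective map $\varphi:\{0,1\}^m\to\mathcal{B}(n,w)$ that is $G$-dominating for some domination graph $G=([m]\cup[n],E)$. *)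

theory Defs
  imports Complex_Main "HOL-Library.FuncSet"
begin

(* The words are extensional functions (value undefined outside {1..n}), so
   that equality of words, and hence injectivity of maps between cubes, depends
   on the coordinates 1, ..., n only. *)
definition cube :: "nat \<Rightarrow> (nat \<Rightarrow> nat) set" where
  "cube n = {1..n} \<rightarrow>\<^sub>E {0, 1}"

definition wt :: "nat \<Rightarrow> (nat \<Rightarrow> nat) \<Rightarrow> nat" where
  "wt n y = card {j \<in> {1..n}. y j \<noteq> 0}"

definition hamming_ball :: "nat \<Rightarrow> nat \<Rightarrow> (nat \<Rightarrow> nat) set" where
  "hamming_ball n w = {y \<in> cube n. wt n y \<le> w}"

(* A bipartite graph with left vertices [m] and right vertices [n] is given by
   its edge set: (i, j) joins the left vertex i to the right vertex j.  The
   position in the pair keeps the two copies disjoint. *)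
definition domination_graph :: "nat \<Rightarrow> nat \<Rightarrow> (nat \<times> nat) set \<Rightarrow> bool" where
  "domination_graph m n E \<longleftrightarrow>
     E \<subseteq> {1..m} \<times> {1..n} \<and> (\<forall>j\<in>{1..n}. \<exists>i\<in>{1..m}. (i, j) \<in> E)"

definition dominating ::
    "nat \<Rightarrow> nat \<Rightarrow> nat \<Rightarrow> (nat \<times> nat) set \<Rightarrow> ((nat \<Rightarrow> nat) \<Rightarrow> (nat \<Rightarrow> nat)) \<Rightarrow> bool" where
  "dominating m n w E \<phi> \<longleftrightarrow>
     \<phi> \<in> cube m \<rightarrow> hamming_ball n w \<and> inj_on \<phi> (cube m) \<and>
     (\<forall>x\<in>cube m. \<forall>(i, j)\<in>E. x i = 0 \<longrightarrow> \<phi> x j = 0)"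

definition domination_mapping ::
    "nat \<Rightarrow> nat \<Rightarrow> nat \<Rightarrow> ((nat \<Rightarrow> nat) \<Rightarrow> (nat \<Rightarrow> nat)) \<Rightarrow> bool" where
  "domination_mapping m n w \<phi> \<longleftrightarrow> (\<exists>E. domination_graph m n E \<and> dominating m n w E \<phi>)"

end

theory Submission
  imports Defs "HOL-Combinatorics.Transposition" "HOL-Real_Asymp.Real_Asymp"
begin

text \<open>
  Identify words with their supports. Colour the right vertices \<open>1, \<dots>, n\<close> evenly with the
  left vertices \<open>1, \<dots>, m\<close> by a map \<open>c\<close>, and join each right vertex only to its colour. A
  dominating map sends each \<open>S \<subseteq> [m]\<close> to some \<open>Y\<close> in the ball with \<open>c(Y) \<subseteq> S\<close>, so by Hall's
  theorem it suffices that every down-set \<open>F\<close> of subsets of \<open>[m]\<close> satisfies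
  \<open>|F| \<le> |{Y. c(Y) \<in> F}|\<close>.

  Take a maximal disjoint family of \<open>r\<close> sets of size at most \<open>w\<close> outside \<open>F\<close>. No member of
  \<open>F\<close> contains one of them, so \<open>|F| \<le> 2^m (1 - 2^-w)^r\<close>. By maximality, every \<open>Y\<close> with
  \<open>c(Y) \<notin> F\<close> has a colour in the union of the family; double counting bounds the number of such
  \<open>Y\<close> by \<open>2 r w^2 / m\<close> times the size of the ball, which suffices if \<open>r\<close> is less than a small
  multiple of \<open>m\<close>. Otherwise \<open>|F| / 2^m\<close> is exponentially small in \<open>m\<close>, whereas the words
  supported on one colour class already number at least \<open>2^m\<close> over a polynomial in \<open>m\<close>.
\<close>

section \<open>Hall's marriage theorem\<close>

text \<open>
  Rado's reduction: if deleting \<open>x\<close> and deleting \<open>y\<close> both break Hall's condition, then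
  submodularity of the size of the union makes \<open>J \<union> K \<union> {i}\<close> or \<open>J \<inter> K\<close> violate it already.
\<close>

lemma hall_remove_element:
  assumes "finite I" "\<And>i. i \<in> I \<Longrightarrow> finite (A i)"
    and hall: "\<And>J. J \<subseteq> I \<Longrightarrow> card J \<le> card (\<Union>(A ` J))"
    and i: "i \<in> I" and xy: "x \<in> A i" "y \<in> A i" "x \<noteq> y"
  shows "\<exists>z\<in>A i. \<forall>J\<subseteq>I. card J \<le> card (\<Union>((A(i := A i - {z})) ` J))"
proof (rule ccontr)
  assume neg: "\<not> ?thesis"
  \<comment> \<open>A violating \<open>J\<close> must contain \<open>i\<close>, since otherwise the
    deletion changes nothing. Splitting \<open>i\<close> off lowers the count by one and turns the
    strict inequality into a weak one.\<close>
  have violator: "\<exists>J\<subseteq>I - {i}. card (\<Union>(A ` J) \<union> (A i - {z})) \<le> card J" if "z \<in> A i" for z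
  proof -
    from neg that obtain J where J: "J \<subseteq> I" "card (\<Union>((A(i := A i - {z})) ` J)) < card J"
      by (auto simp: not_le)
    have "i \<in> J"
    proof (rule ccontr)
      assume "i \<notin> J"
      then have "\<Union>((A(i := A i - {z})) ` J) = \<Union>(A ` J)"
        by auto
      then show False using J hall[of J] by auto
    qed
    have "\<Union>((A(i := A i - {z})) ` J) = \<Union>(A ` (J - {i})) \<union> (A i - {z})"
      using \<open>i \<in> J\<close> by auto
    then have "card (\<Union>(A ` (J - {i})) \<union> (A i - {z})) \<le> card (J - {i})"
      using J \<open>i \<in> J\<close> by simp
    then show ?thesis using J by (intro exI[of _ "J - {i}"]) auto
  qed
  obtain J where J: "J \<subseteq> I - {i}" "card (\<Union>(A ` J) \<union> (A i - {x})) \<le> card J"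
    using violator[OF xy(1)] by blast
  obtain K where K: "K \<subseteq> I - {i}" "card (\<Union>(A ` K) \<union> (A i - {y})) \<le> card K"
    using violator[OF xy(2)] by blast
  let ?X = "\<Union>(A ` J) \<union> (A i - {x})" and ?Y = "\<Union>(A ` K) \<union> (A i - {y})"
  have fin: "finite J" "finite K" using J K assms(1) by (auto intro: finite_subset)
  have finXY: "finite ?X" "finite ?Y" using fin J K assms(2) i by auto
  have "card (insert i (J \<union> K)) \<le> card (\<Union>(A ` insert i (J \<union> K)))"
    using J K i by (intro hall) auto
  \<comment> \<open>Since \<open>x\<close> and \<open>y\<close> differ, the parts of
    \<open>A i\<close> kept in \<open>?X\<close> and in \<open>?Y\<close> together cover all of
    \<open>A i\<close>.\<close>
  also have "\<Union>(A ` insert i (J \<union> K)) = ?X \<union> ?Y"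
    using xy by auto
  finally have "Suc (card (J \<union> K)) \<le> card (?X \<union> ?Y)"
    using fin J K by (subst (asm) card_insert_disjoint) auto
  moreover have "card (J \<inter> K) \<le> card (\<Union>(A ` (J \<inter> K)))"
    using J by (intro hall) auto
  moreover have "card (\<Union>(A ` (J \<inter> K))) \<le> card (?X \<inter> ?Y)"
    using finXY by (intro card_mono) auto
  moreover have "card J + card K = card (J \<union> K) + card (J \<inter> K)"
    using fin by (rule card_Un_Int)
  moreover have "card ?X + card ?Y = card (?X \<union> ?Y) + card (?X \<inter> ?Y)"
    using finXY by (rule card_Un_Int)
  ultimately show False using J K by linarith
qed

text \<open>Elements are deleted one at a time, with the total size as induction measure, until
  every set is a singleton; Hall's condition on pairs then makes these singletons distinct.\<close>

theorem hall_marriage: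
  assumes "finite I" "\<And>i. i \<in> I \<Longrightarrow> finite (A i)"
    and "\<And>J. J \<subseteq> I \<Longrightarrow> card J \<le> card (\<Union>(A ` J))"
  shows "\<exists>f. inj_on f I \<and> (\<forall>i\<in>I. f i \<in> A i)"
  using assms(2,3)
proof (induction "\<Sum>i\<in>I. card (A i)" arbitrary: A rule: less_induct)
  case less
  have ne: "A i \<noteq> {}" if "i \<in> I" for i
    using less.prems(2)[of "{i}"] that by auto
  show ?case
  proof (cases "\<exists>i\<in>I. \<exists>x\<in>A i. \<exists>y\<in>A i. x \<noteq> y")
    case True
    then obtain i x y where i: "i \<in> I" and xy: "x \<in> A i" "y \<in> A i" "x \<noteq> y" by blast
    obtain z where z: "z \<in> A i"
      "\<And>J. J \<subseteq> I \<Longrightarrow> card J \<le> card (\<Union>((A(i := A i - {z})) ` J))"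
      using hall_remove_element[OF assms(1) less.prems i xy] by blast
    have "(\<Sum>j\<in>I. card ((A(i := A i - {z})) j)) < (\<Sum>j\<in>I. card (A j))"
    proof (rule sum_strict_mono_ex1)
      show "\<exists>j\<in>I. card ((A(i := A i - {z})) j) < card (A j)"
        using card_Diff1_less[OF less.prems(1)[OF i] z(1)] i by (intro bexI[of _ i]) (simp_all del: card_Diff_insert)
    qed (auto simp: assms(1) less.prems(1) card_mono)
    moreover have "finite ((A(i := A i - {z})) j)" if "j \<in> I" for j
      using less.prems(1) that i by simp
    ultimately obtain f where "inj_on f I" "\<forall>j\<in>I. f j \<in> (A(i := A i - {z})) j"
      using less.hyps[OF _ _ z(2)] by blast
    then show ?thesis by (intro exI[of _ f]) (auto split: if_splits)
  next
    case False
    define f where "f i = (SOME x. x \<in> A i)" for i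
    have f: "f i \<in> A i" if "i \<in> I" for i
      using ne[OF that] unfolding f_def by (simp add: some_in_eq)
    then have single: "A i = {f i}" if "i \<in> I" for i using False that by blast
    have "inj_on f I"
    proof (rule inj_onI, rule ccontr)
      fix i j assume *: "i \<in> I" "j \<in> I" "f i = f j" "i \<noteq> j"
      then have "\<Union>(A ` {i, j}) = {f i}" using single by auto
      then show False using less.prems(2)[of "{i, j}"] * by simp
    qed
    then show ?thesis using f by blast
  qed
qed

section \<open>Counting sets of bounded size\<close>

text \<open>With \<open>P = {1..n}\<close> these are the supports of the words in
  \<open>hamming_ball n w\<close>.\<close>

definition small_subsets :: "'a set \<Rightarrow> nat \<Rightarrow> 'a set set" where
  "small_subsets P w = {Y. Y \<subseteq> P \<and> card Y \<le> w}"

lemma finite_small_subsets: "finite P \<Longrightarrow> finite (small_subsets P w)"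
  unfolding small_subsets_def by (rule finite_subset[of _ "Pow P"]) auto

text \<open>Such a set is built in \<open>w\<close> rounds, each adding one of the
  \<open>card P\<close> elements or, for the option \<open>None\<close>, nothing.\<close>

lemma card_small_subsets_le:
  assumes "finite P"
  shows "card (small_subsets P w) \<le> (card P + 1) ^ w"
proof (induction w)
  case 0
  have "small_subsets P 0 = {{}}"
    using assms by (auto simp: small_subsets_def dest: finite_subset)
  then show ?case by simp
next
  case (Suc w)
  let ?g = "\<lambda>Y z. case z of None \<Rightarrow> Y | Some a \<Rightarrow> insert a Y"
  let ?A = "insert None (Some ` P)"
  have "small_subsets P (Suc w) \<subseteq> (\<lambda>(z, Y). ?g Y z) ` (?A \<times> small_subsets P w)"
  proof
    fix Y assume Y: "Y \<in> small_subsets P (Suc w)"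
    show "Y \<in> (\<lambda>(z, Y). ?g Y z) ` (?A \<times> small_subsets P w)"
    proof (cases "Y = {}")
      case True
      then show ?thesis
        by (intro image_eqI[of _ _ "(None, {})"]) (auto simp: small_subsets_def)
    next
      case False
      then obtain a where "a \<in> Y" by auto
      then show ?thesis using Y assms
        by (intro image_eqI[of _ _ "(Some a, Y - {a})"])
          (auto simp: small_subsets_def card_Diff_singleton dest: finite_subset)
    qed
  qed
  then have "card (small_subsets P (Suc w)) \<le> card (?A \<times> small_subsets P w)"
    using assms finite_small_subsets by (intro surj_card_le finite_cartesian_product) auto
  also have "\<dots> = (card P + 1) * card (small_subsets P w)"
    using assms by (simp add: card_cartesian_product card_image)
  also have "\<dots> \<le> (card P + 1) * (card P + 1) ^ w"
    using Suc.IH by (intro mult_left_mono) auto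
  finally show ?case by simp
qed

text \<open>Transpositions of \<open>P\<close> permute the small subsets, so every element of
  \<open>P\<close> lies in equally many of them; counting incident pairs then gives the
  bound.\<close>

lemma card_small_subsets_containing:
  assumes "finite P" "j \<in> P"
  shows "card P * card {Y \<in> small_subsets P w. j \<in> Y} \<le> w * card (small_subsets P w)"
proof -
  let ?B = "small_subsets P w"
  have eq: "card {Y \<in> ?B. k \<in> Y} = card {Y \<in> ?B. j \<in> Y}" if "k \<in> P" for k
  proof (rule bij_betw_same_card)
    have maps: "transpose j k ` Y \<in> ?B" if "Y \<in> ?B" for Y
    proof -
      have "transpose j k ` Y \<subseteq> transpose j k ` P"
        using that by (auto simp: small_subsets_def)
      moreover have "transpose j k ` P = P"
        using assms(2) \<open>k \<in> P\<close> by simp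
      moreover have "card (transpose j k ` Y) = card Y"
        by (intro card_image inj_on_subset[OF inj_transpose]) auto
      ultimately show ?thesis using that by (auto simp: small_subsets_def)
    qed
    have invol: "transpose j k ` (transpose j k ` Y) = Y" for Y
      by (simp add: image_comp)
    have mem: "j \<in> transpose j k ` Y" if "k \<in> Y" for Y
      using that by (intro rev_image_eqI[of k]) auto
    have mem': "k \<in> transpose j k ` Y" if "j \<in> Y" for Y
      using that by (intro rev_image_eqI[of j]) auto
    show "bij_betw ((`) (transpose j k)) {Y \<in> ?B. k \<in> Y} {Y \<in> ?B. j \<in> Y}"
      by (rule bij_betw_byWitness[where f' = "(`) (transpose j k)"])
        (use maps invol mem mem' in blast)+
  qed
  have "card P * card {Y \<in> ?B. j \<in> Y} = (\<Sum>k\<in>P. card {Y \<in> ?B. k \<in> Y})"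
    using eq by simp
  also have "\<dots> = (\<Sum>Y\<in>?B. card {k \<in> P. k \<in> Y})"
    using assms finite_small_subsets by (intro sum_multicount_gen[symmetric]) auto
  also have "\<dots> \<le> (\<Sum>Y\<in>?B. w)"
  proof (rule sum_mono)
    fix Y assume "Y \<in> ?B"
    then show "card {k \<in> P. k \<in> Y} \<le> w"
      by (auto simp: small_subsets_def Int_absorb1 Collect_conj_eq)
  qed
  finally show ?thesis by (simp add: mult.commute)
qed

lemma card_small_subsets_meeting:
  assumes "finite P" "X \<subseteq> P"
  shows "card P * card {Y \<in> small_subsets P w. Y \<inter> X \<noteq> {}} \<le> card X * (w * card (small_subsets P w))"
proof -
  let ?B = "small_subsets P w"
  have finX: "finite X" using assms by (rule rev_finite_subset)
  have "{Y \<in> ?B. Y \<inter> X \<noteq> {}} = (\<Union>j\<in>X. {Y \<in> ?B. j \<in> Y})" by auto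
  then have "card P * card {Y \<in> ?B. Y \<inter> X \<noteq> {}} \<le> card P * (\<Sum>j\<in>X. card {Y \<in> ?B. j \<in> Y})"
    using mult_le_mono2[OF card_UN_le[OF finX]] by simp
  also have "\<dots> = (\<Sum>j\<in>X. card P * card {Y \<in> ?B. j \<in> Y})"
    by (rule sum_distrib_left)
  also have "\<dots> \<le> (\<Sum>j\<in>X. w * card ?B)"
  proof (rule sum_mono)
    fix j assume "j \<in> X"
    then show "card P * card {Y \<in> ?B. j \<in> Y} \<le> w * card ?B"
      using assms by (intro card_small_subsets_containing) auto
  qed
  finally show ?thesis by simp
qed

section \<open>Subsets containing no member of a disjoint family\<close>

text \<open>A uniformly random \<open>S\<close> contains disjoint sets independently, each with
  probability at least \<open>1 / 2 ^ w\<close>. The induction peels off one \<open>A\<close>: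
  \<open>S\<close> is determined by its trace on \<open>A\<close>, which is a proper subset of
  \<open>A\<close>, and by its part outside \<open>A\<close>.\<close>

lemma card_subsets_avoiding_disjoint_family:
  assumes "finite M" "finite V" "\<And>A. A \<in> M \<Longrightarrow> A \<subseteq> V \<and> card A \<le> w"
    and "pairwise disjnt M"
  shows "real (card {S. S \<subseteq> V \<and> (\<forall>A\<in>M. \<not> A \<subseteq> S)}) \<le> 2 ^ card V * (1 - 1 / 2 ^ w) ^ card M"
  using assms
proof (induction M arbitrary: V rule: finite_induct)
  case empty
  then show ?case by (simp add: card_Pow flip: Pow_def)
next
  case (insert A M)
  let ?N = "\<lambda>V M. {S. S \<subseteq> V \<and> (\<forall>A\<in>M. \<not> A \<subseteq> S)}"
  have A: "A \<subseteq> V" "card A \<le> w" "finite A"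
    using insert.prems by (auto intro: finite_subset)
  have disj: "A \<inter> A' = {}" if "A' \<in> M" for A'
    using insert.prems(3) insert.hyps(2) that by (auto simp: pairwise_insert disjnt_def)
  have fin: "finite (?N (V - A) M)"
    by (rule finite_subset[OF _ finite_Pow_iff[THEN iffD2, OF insert.prems(1)]]) blast
  have IH: "real (card (?N (V - A) M)) \<le> 2 ^ card (V - A) * (1 - 1 / 2 ^ w) ^ card M"
  proof (rule insert.IH)
    show "finite (V - A)" "pairwise disjnt M"
      using insert.prems by (simp_all add: pairwise_insert)
    show "A' \<subseteq> V - A \<and> card A' \<le> w" if "A' \<in> M" for A'
      using insert.prems(2)[of A'] disj[OF that] that by blast
  qed
  have "inj_on (\<lambda>S. (S \<inter> A, S - A)) (?N V (insert A M))"
    by (rule inj_onI) blast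
  moreover have "(\<lambda>S. (S \<inter> A, S - A)) ` ?N V (insert A M) \<subseteq> (Pow A - {A}) \<times> ?N (V - A) M"
    using disj by blast
  ultimately have "card (?N V (insert A M)) \<le> card ((Pow A - {A}) \<times> ?N (V - A) M)"
    using A fin by (intro card_inj_on_le) auto
  also have "\<dots> = (2 ^ card A - 1) * card (?N (V - A) M)"
    using A by (simp add: card_cartesian_product card_Pow card_Diff_singleton)
  finally have "real (card (?N V (insert A M))) \<le> real ((2 ^ card A - 1) * card (?N (V - A) M))"
    by (rule of_nat_mono)
  also have "\<dots> = (2 ^ card A - 1) * real (card (?N (V - A) M))"
    by (simp add: of_nat_diff)
  also have "\<dots> \<le> (2 ^ card A - 1) * (2 ^ card (V - A) * (1 - 1 / 2 ^ w) ^ card M)"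
    by (intro mult_left_mono IH) auto
  also have "\<dots> = (1 - 1 / 2 ^ card A) * (2 ^ card A * 2 ^ card (V - A)) * (1 - 1 / 2 ^ w) ^ card M"
    by (simp add: field_simps)
  also have "2 ^ card A * 2 ^ card (V - A) = (2 ^ card V :: real)"
    using A insert.prems(1) by (simp add: card_Diff_subset card_mono flip: power_add)
  also have "(1 - 1 / 2 ^ card A) * 2 ^ card V * (1 - 1 / 2 ^ w) ^ card M
      \<le> (1 - 1 / 2 ^ w) * 2 ^ card V * (1 - 1 / 2 ^ w :: real) ^ card M"
    using A(2) by (intro mult_right_mono) (auto intro!: divide_left_mono power_increasing)
  also have "\<dots> = 2 ^ card V * (1 - 1 / 2 ^ w) ^ card (insert A M)"
    using insert.hyps by simp
  finally show ?case .
qed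

section \<open>Exponential decay against polynomial growth\<close>

lemma eventually_power_times_exp_le_1:
  fixes c d :: real
  assumes "c > 0" "d > 0"
  shows "eventually (\<lambda>m::nat. (c * real m) ^ w * exp (- d * real m) \<le> 1) sequentially"
  using assms by real_asymp

text \<open>As \<open>ln q < 0\<close>, every \<open>r\<close> in this range makes
  \<open>q ^ r\<close> at most \<open>exp (e * ln q * m)\<close>, which beats the polynomial factor
  uniformly in \<open>r\<close>.\<close>

lemma eventually_power_times_small_power_le_1:
  fixes c e q :: real
  assumes "c > 0" "e > 0" "0 < q" "q < 1"
  shows "eventually (\<lambda>m::nat. \<forall>r::nat. e * real m \<le> real r \<longrightarrow> (c * real m) ^ w * q ^ r \<le> 1) sequentially"
proof -
  have "eventually (\<lambda>m::nat. (c * real m) ^ w * exp (- (e * - ln q) * real m) \<le> 1) sequentially"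
    using assms by (intro eventually_power_times_exp_le_1) (auto intro: mult_pos_neg)
  then show ?thesis
  proof eventually_elim
    case (elim m)
    show ?case
    proof (intro allI impI)
      fix r :: nat assume r: "e * real m \<le> real r"
      have "q ^ r = exp (real r * ln q)"
        using assms by (simp add: exp_of_nat_mult)
      also have "\<dots> \<le> exp (- (e * - ln q) * real m)"
        using mult_right_mono_neg[OF r, of "ln q"] assms by (simp add: mult_ac)
      finally have "(c * real m) ^ w * q ^ r \<le> (c * real m) ^ w * exp (- (e * - ln q) * real m)"
        using assms by (intro mult_left_mono) auto
      then show "(c * real m) ^ w * q ^ r \<le> 1"
        using elim by linarith
    qed
  qed
qed

section \<open>Hall's condition for down-sets\<close>

text \<open>\<open>P\<close> stands for the right vertices and \<open>V\<close> for the colours.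
  \<open>upper\<close> bounds the words lost when the disjoint family is small; \<open>lower\<close>
  and \<open>decay\<close> make a single colour class suffice when it is large.\<close>

lemma card_downset_le:
  fixes c :: "'b \<Rightarrow> 'a"
  assumes fin: "finite P" "finite V" and c: "c \<in> P \<rightarrow> V" and w: "w \<ge> 1"
    and total: "2 ^ card V \<le> card (small_subsets P w)"
    and upper: "\<And>i. i \<in> V \<Longrightarrow> card V * card (P \<inter> c -` {i}) \<le> 2 * card P"
    and lower: "\<And>i. i \<in> V \<Longrightarrow> card P + 1 \<le> 4 * card V * card (P \<inter> c -` {i})"
      "\<And>i. i \<in> V \<Longrightarrow> w \<le> card (P \<inter> c -` {i})"
    and decay: "\<And>r. card V \<le> 2 ^ (w + 1) * w\<^sup>2 * r \<Longrightarrow>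
      (4 * real w * real (card V)) ^ w * (1 - 1 / 2 ^ w) ^ r \<le> 1"
    and F: "F \<subseteq> Pow V" "\<And>S T. S \<in> F \<Longrightarrow> T \<subseteq> S \<Longrightarrow> T \<in> F"
  shows "card F \<le> card {Y \<in> small_subsets P w. c ` Y \<in> F}"
proof (cases "F \<subseteq> {{}}")
  case True
  then consider "F = {}" | "F = {{}}" by blast
  then show ?thesis
  proof cases
    case 2
    have "{} \<in> {Y \<in> small_subsets P w. c ` Y \<in> F}"
      using 2 by (simp add: small_subsets_def)
    moreover have "finite {Y \<in> small_subsets P w. c ` Y \<in> F}"
      using finite_small_subsets[OF fin(1)] by simp
    ultimately have "0 < card {Y \<in> small_subsets P w. c ` Y \<in> F}"
      by (auto simp: card_gt_0_iff)
    then show ?thesis using 2 by simp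
  qed simp
next
  case False
  then obtain S i where "S \<in> F" "i \<in> S" by auto
  \<comment> \<open>Downward closure supplies both: the singleton serves the case of a large family,
    the empty set shows that members of \<open>U\<close> are nonempty.\<close>
  then have i: "{i} \<in> F" "i \<in> V" and empty: "{} \<in> F"
    using F by auto
  let ?B = "small_subsets P w" and ?\<rho> = "1 - 1 / 2 ^ w :: real"
  let ?N = "{Y \<in> ?B. c ` Y \<in> F}" and ?C = "\<lambda>X. P \<inter> c -` X"
  have finB: "finite ?B" using fin(1) by (rule finite_small_subsets)
  have \<rho>: "0 \<le> ?\<rho>" "?\<rho> \<le> 1" by simp_all
  define U where "U = {A. A \<subseteq> V \<and> card A \<le> w \<and> A \<notin> F}"
  have finU: "finite U" using fin(2) by (intro finite_subset[of U "Pow V"]) (auto simp: U_def)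
  define \<F> where "\<F> = {M. M \<subseteq> U \<and> pairwise disjnt M}"
  have "finite \<F>"
    unfolding \<F>_def by (rule finite_subset[of _ "Pow U"]) (use finU in auto)
  moreover have "{} \<in> \<F>" by (simp add: \<F>_def)
  ultimately obtain M where M_\<F>: "M \<in> \<F>" and M_max: "\<forall>M'\<in>\<F>. M \<subseteq> M' \<longrightarrow> M = M'"
    using finite_has_maximal[of \<F>] by auto
  then have M: "M \<subseteq> U" "pairwise disjnt M"
    by (simp_all add: \<F>_def)
  have maximal: "M = M'" if "M' \<subseteq> U" "pairwise disjnt M'" "M \<subseteq> M'" for M'
    using M_max that by (simp add: \<F>_def)
  define X where "X = \<Union>M"
  let ?r = "card M"
  have finM: "finite M" using M(1) finU by (rule finite_subset)
  have XV: "X \<subseteq> V" using M(1) by (auto simp: X_def U_def)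
  \<comment> \<open>By maximality a member of \<open>U\<close> disjoint from \<open>X\<close> would
    belong to \<open>M\<close>, hence lie inside \<open>X\<close> and be empty; but the empty set is
    in \<open>F\<close>.\<close>
  have meets: "A \<inter> X \<noteq> {}" if "A \<in> U" for A
  proof
    assume "A \<inter> X = {}"
    then have "pairwise disjnt (insert A M)"
      using M(2) by (auto simp: pairwise_insert disjnt_def X_def)
    then have "A \<in> M" using maximal[of "insert A M"] M(1) that by auto
    then have "A = {}" using \<open>A \<inter> X = {}\<close> by (auto simp: X_def)
    then show False using that empty by (simp add: U_def)
  qed
  have "card X \<le> (\<Sum>A\<in>M. card A)"
    unfolding X_def by (rule card_Union_le_sum_card)
  also have "\<dots> \<le> (\<Sum>A\<in>M. w)"
    using M(1) by (intro sum_mono) (auto simp: U_def)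
  finally have cardX: "card X \<le> ?r * w" by simp
  have "F \<subseteq> {S. S \<subseteq> V \<and> (\<forall>A\<in>M. \<not> A \<subseteq> S)}"
    using F M(1) by (auto simp: U_def)
  then have "card F \<le> card {S. S \<subseteq> V \<and> (\<forall>A\<in>M. \<not> A \<subseteq> S)}"
    using fin(2) by (intro card_mono) simp_all
  also have "real \<dots> \<le> 2 ^ card V * ?\<rho> ^ ?r"
    using M fin(2) finM by (intro card_subsets_avoiding_disjoint_family) (auto simp: U_def)
  finally have cardF: "real (card F) \<le> 2 ^ card V * ?\<rho> ^ ?r" by simp
  have missing: "?B - ?N \<subseteq> {Y \<in> ?B. Y \<inter> ?C X \<noteq> {}}"
  proof
    fix Y assume Y: "Y \<in> ?B - ?N"
    then have "Y \<subseteq> P" "card Y \<le> w" by (auto simp: small_subsets_def)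
    then have "c ` Y \<in> U" using Y c fin(1) card_image_le[of Y c] finite_subset[of Y P]
      by (auto simp: U_def)
    from meets[OF this] Y \<open>Y \<subseteq> P\<close> show "Y \<in> {Y \<in> ?B. Y \<inter> ?C X \<noteq> {}}" by auto
  qed
  show ?thesis
  \<comment> \<open>The threshold brings the loss bound \<open>2 * w\<^sup>2 * ?r / card V\<close>
    down to \<open>1 / 2 ^ w\<close>, which is what a single member of \<open>M\<close> gains in
    \<open>cardF\<close>.\<close>
  proof (cases "2 ^ (w + 1) * w\<^sup>2 * ?r < card V")
    case True
    have "card (?B - ?N) \<le> card {Y \<in> ?B. Y \<inter> ?C X \<noteq> {}}" (is "?b \<le> ?b'")
      using finB missing by (intro card_mono) auto
    have "?C X = (\<Union>i\<in>X. ?C {i})" by auto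
    then have "card (?C X) \<le> (\<Sum>i\<in>X. card (?C {i}))"
      using card_UN_le[OF finite_subset[OF XV fin(2)], of "\<lambda>i. ?C {i}"] by simp
    then have "card V * card (?C X) \<le> (\<Sum>i\<in>X. card V * card (?C {i}))"
      unfolding sum_distrib_left[symmetric] by (rule mult_le_mono2)
    also have "\<dots> \<le> (\<Sum>i\<in>X. 2 * card P)"
      using XV by (intro sum_mono upper) auto
    also have "\<dots> \<le> ?r * w * (2 * card P)"
      using cardX by simp
    finally have classes: "card V * card (?C X) \<le> ?r * w * (2 * card P)" .
    \<comment> \<open>At most a fraction \<open>w * card (?C X) / card P\<close> of the small
      subsets meets \<open>?C X\<close>, and \<open>classes\<close> bounds
      \<open>card (?C X)\<close>. Denominators are multiplied out to stay in the natural
      numbers.\<close>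
    have "card P * ?b' \<le> card (?C X) * (w * card ?B)"
      using fin(1) by (intro card_small_subsets_meeting) auto
    then have "card V * (card P * ?b') \<le> card V * (card (?C X) * (w * card ?B))"
      by (rule mult_le_mono2)
    also have "\<dots> \<le> ?r * w * (2 * card P) * (w * card ?B)"
      using mult_le_mono1[OF classes] by (simp only: mult.assoc)
    finally have "card P * (card V * ?b') \<le> card P * (2 * w\<^sup>2 * ?r * card ?B)"
      by (simp add: power2_eq_square mult_ac)
    moreover have "card P > 0"
      using lower(2)[OF i(2)] w card_mono[OF fin(1), of "?C {i}"] by auto
    ultimately have "card V * ?b' \<le> 2 * w\<^sup>2 * ?r * card ?B"
      by simp
    then have "2 ^ w * (card V * ?b') \<le> 2 ^ w * (2 * w\<^sup>2 * ?r * card ?B)"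
      by (rule mult_le_mono2)
    also have "\<dots> = 2 ^ (w + 1) * w\<^sup>2 * ?r * card ?B"
      by (simp add: mult_ac)
    also have "\<dots> \<le> card V * card ?B"
      using True by (intro mult_le_mono1) simp
    finally have "card V * (2 ^ w * ?b') \<le> card V * card ?B"
      by (simp add: mult_ac)
    then have "2 ^ w * ?b' \<le> card ?B"
      using True by simp
    then have "2 ^ w * ?b \<le> card ?B"
      using mult_le_mono2[OF \<open>?b \<le> ?b'\<close>, of "2 ^ w"] by linarith
    then have "real (2 ^ w * ?b) \<le> real (card ?B)"
      by (rule of_nat_mono)
    then have b: "real ?b \<le> real (card ?B) / 2 ^ w"
      by (simp add: field_simps)
    have N: "card ?N = card ?B - ?b" "?b \<le> card ?B"
      using finB by (auto simp: card_Diff_subset card_mono)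
    show ?thesis
    \<comment> \<open>An empty family has no factor to spare, but then nothing is lost and
      \<open>total\<close> suffices; otherwise one factor \<open>?\<rho>\<close> makes up for the
      whole loss.\<close>
    proof (cases "M = {}")
      case True
      then have "?N = ?B" using missing by (auto simp: X_def)
      moreover have "card F \<le> card (Pow V)"
        using F(1) fin(2) by (intro card_mono) auto
      ultimately show ?thesis using total fin(2) by (simp add: card_Pow)
    next
      case False
      then have "?\<rho> ^ ?r \<le> ?\<rho> ^ 1"
        using finM \<rho> by (intro power_decreasing) (auto simp: Suc_le_eq card_gt_0_iff)
      then have "real (card F) \<le> 2 ^ card V * ?\<rho>"
        using cardF by (elim order_trans) (simp add: mult_left_mono)
      also have "\<dots> \<le> real (card ?B) * ?\<rho>"
      proof (rule mult_right_mono[OF _ \<rho>(1)])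
        show "2 ^ card V \<le> real (card ?B)"
          using of_nat_mono[OF total, where 'a = real] by simp
      qed
      also have "\<dots> \<le> real (card ?N)"
        using b N by (simp add: of_nat_diff algebra_simps)
      finally show ?thesis by simp
    qed
  next
    case False
    \<comment> \<open>These sets use the single colour \<open>i\<close>, and \<open>{i}\<close> is
      in \<open>F\<close>.\<close>
    let ?Y = "{Y. Y \<subseteq> ?C {i} \<and> card Y = w}"
    have "?Y \<subseteq> ?N"
    proof
      fix Y assume Y: "Y \<in> ?Y"
      then have "Y \<noteq> {}" using w by auto
      then have "c ` Y = {i}" using Y by auto
      then show "Y \<in> ?N" using Y i by (auto simp: small_subsets_def)
    qed
    then have "card ?Y \<le> card ?N"
      using finB by (intro card_mono) auto
    moreover have "card ?Y = card (?C {i}) choose w"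
      using fin(1) by (intro n_subsets) auto
    ultimately have N: "(real (card (?C {i})) / real w) ^ w \<le> real (card ?N)"
      using binomial_ge_n_over_k_pow_k[OF lower(2)[OF i(2)], where 'a = real] by simp
    \<comment> \<open>By \<open>total\<close> the ball is large, which forces \<open>P\<close>, and
      by \<open>lower\<close> the class of \<open>i\<close>, to be large: its
      \<open>w\<close>-subsets number at least \<open>2 ^ card V\<close> over a polynomial in
      \<open>card V\<close>.\<close>
    have "2 ^ card V \<le> (card P + 1) ^ w"
      using total card_small_subsets_le[OF fin(1), of w] by linarith
    also have "\<dots> \<le> (4 * card V * card (?C {i})) ^ w"
      by (intro power_mono lower i) auto
    finally have "real (2 ^ card V) \<le> real ((4 * card V * card (?C {i})) ^ w)"
      by (rule of_nat_mono)
    also have "\<dots> = (4 * real w * real (card V)) ^ w * (real (card (?C {i})) / real w) ^ w"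
    proof -
      have "real (4 * card V * card (?C {i})) = (4 * real w * real (card V)) * (real (card (?C {i})) / real w)"
        using w by simp
      then show ?thesis
        by (simp only: of_nat_power power_mult_distrib[symmetric])
    qed
    also have "\<dots> \<le> (4 * real w * real (card V)) ^ w * real (card ?N)"
      by (intro mult_left_mono N) auto
    finally have "2 ^ card V \<le> (4 * real w * real (card V)) ^ w * real (card ?N)"
      by (simp only: of_nat_power of_nat_numeral)
    then have "2 ^ card V * ?\<rho> ^ ?r \<le> (4 * real w * real (card V)) ^ w * real (card ?N) * ?\<rho> ^ ?r"
      using \<rho>(1) by (rule mult_right_mono[OF _ zero_le_power])
    also have "\<dots> = ((4 * real w * real (card V)) ^ w * ?\<rho> ^ ?r) * real (card ?N)"
      by (simp only: mult_ac)
    also have "\<dots> \<le> 1 * real (card ?N)"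
      using False by (intro mult_right_mono decay) auto
    finally show ?thesis using cardF by linarith
  qed
qed

section \<open>An even colouring by residues\<close>

text \<open>Each of the \<open>n div m\<close> full blocks of \<open>m\<close> consecutive numbers
  contains the residue once; conversely, a member of the class is determined by its quotient, one of
  \<open>0, ..., n div m\<close>.\<close>

lemma card_residue_class:
  fixes m n a :: nat
  assumes "a < m"
  shows "n div m \<le> card {j \<in> {1..n}. j mod m = a}" "card {j \<in> {1..n}. j mod m = a} \<le> n div m + 1"
proof -
  let ?R = "{j \<in> {1..n}. j mod m = a}"
  \<comment> \<open>The representative is taken in \<open>{1..m}\<close> because the coordinates
    start at 1.\<close>
  define b where "b = (if a = 0 then m else a)"
  have b: "b mod m = a" "1 \<le> b" "b \<le> m" using assms by (auto simp: b_def)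
  have "(\<lambda>k. k * m + b) ` {..<n div m} \<subseteq> ?R"
  proof safe
    fix k assume "k < n div m"
    then have "(k + 1) * m \<le> n div m * m" by (intro mult_le_mono1) auto
    also have "\<dots> \<le> n" by simp
    finally show "k * m + b \<in> {1..n}" using b by auto
    show "(k * m + b) mod m = a" using b by simp
  qed
  moreover have "inj_on (\<lambda>k. k * m + b) {..<n div m}"
    using assms by (auto simp: inj_on_def)
  ultimately show "n div m \<le> card ?R"
    using card_inj_on_le[of "\<lambda>k. k * m + b" "{..<n div m}" ?R] by simp
  have "inj_on (\<lambda>j. j div m) ?R"
    by (rule inj_onI) (metis (mono_tags, lifting) div_mult_mod_eq mem_Collect_eq)
  moreover have "(\<lambda>j. j div m) ` ?R \<subseteq> {..n div m}"
    by (auto intro: div_le_mono)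
  ultimately show "card ?R \<le> n div m + 1"
    using card_inj_on_le[of "\<lambda>j. j div m" ?R "{..n div m}"] by simp
qed

section \<open>Words and their supports\<close>

definition ones :: "nat \<Rightarrow> (nat \<Rightarrow> nat) \<Rightarrow> nat set" where
  "ones n y = {j \<in> {1..n}. y j \<noteq> 0}"

lemma inj_on_ones: "inj_on (ones n) (cube n)"
proof (rule inj_onI)
  fix x y assume x: "x \<in> cube n" and y: "y \<in> cube n" and eq: "ones n x = ones n y"
  show "x = y"
  proof (rule PiE_ext)
    show "x \<in> {1..n} \<rightarrow>\<^sub>E {0, 1}" "y \<in> {1..n} \<rightarrow>\<^sub>E {0, 1}"
      using x y by (auto simp: cube_def)
    fix j assume j: "j \<in> {1..n}"
    then have "x j \<in> {0, 1}" "y j \<in> {0, 1}" using PiE_mem[of x "{1..n}" "\<lambda>_. {0, 1}" j] PiE_mem[of y "{1..n}" "\<lambda>_. {0, 1}" j] x y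
      unfolding cube_def by blast+
    moreover have "x j \<noteq> 0 \<longleftrightarrow> y j \<noteq> 0" using eq j by (auto simp: ones_def set_eq_iff)
    ultimately show "x j = y j" by auto
  qed
qed

lemma card_hamming_ball_le: "card (hamming_ball n w) \<le> card (small_subsets {1..n} w)"
proof (rule card_inj_on_le)
  show "inj_on (ones n) (hamming_ball n w)"
    using inj_on_ones by (rule inj_on_subset) (auto simp: hamming_ball_def)
  show "ones n ` hamming_ball n w \<subseteq> small_subsets {1..n} w"
    by (auto simp: hamming_ball_def wt_def ones_def small_subsets_def)
qed (simp add: finite_small_subsets)

text \<open>Each \<open>j\<close> is joined only to \<open>c j\<close>. If \<open>x i = 0\<close>,
  then \<open>i\<close> is outside the support of \<open>x\<close>, so by the hypothesis on
  \<open>f\<close> the image has no \<open>j\<close> of colour \<open>i\<close>.\<close>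

lemma domination_mapping_of_subset_map:
  assumes c: "c \<in> {1..n} \<rightarrow> {1..m}" and inj: "inj_on f (Pow {1..m})"
    and f: "\<And>S. S \<subseteq> {1..m} \<Longrightarrow> f S \<in> small_subsets {1..n} w \<and> c ` f S \<subseteq> S"
  shows "\<exists>\<phi>. domination_mapping m n w \<phi>"
proof -
  define \<phi> where "\<phi> x = (\<lambda>j\<in>{1..n}. if j \<in> f (ones m x) then 1 else 0 :: nat)" for x
  define E where "E = (\<lambda>j. (c j, j)) ` {1..n}"
  have sub: "ones m x \<subseteq> {1..m}" for x by (auto simp: ones_def)
  have ones_\<phi>: "ones n (\<phi> x) = f (ones m x)" for x
    using f[OF sub[of x]] by (auto simp: ones_def \<phi>_def small_subsets_def)
  have "domination_graph m n E"
    using c by (auto simp: domination_graph_def E_def)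
  moreover have "\<phi> x \<in> hamming_ball n w" for x
  proof -
    have "wt n (\<phi> x) = card (f (ones m x))"
      using ones_\<phi>[of x] by (simp add: wt_def ones_def)
    then show ?thesis using f[OF sub[of x]]
      by (auto simp: hamming_ball_def small_subsets_def cube_def \<phi>_def)
  qed
  moreover have "inj_on \<phi> (cube m)"
  proof (rule inj_onI)
    fix x y assume xy: "x \<in> cube m" "y \<in> cube m" and "\<phi> x = \<phi> y"
    then have "f (ones m x) = f (ones m y)" using ones_\<phi> by metis
    then have "ones m x = ones m y" using inj_onD[OF inj] sub by blast
    then show "x = y" using inj_onD[OF inj_on_ones] xy by blast
  qed
  moreover have "\<phi> x j = 0" if "(i, j) \<in> E" "x i = 0" for x i j
  proof -
    have "j \<in> {1..n}" "i = c j" using that by (auto simp: E_def)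
    moreover have "i \<notin> ones m x" using that by (simp add: ones_def)
    ultimately show ?thesis using f[OF sub[of x]] by (auto simp: \<phi>_def)
  qed
  ultimately show ?thesis
    unfolding domination_mapping_def dominating_def by blast
qed

section \<open>Choice of the threshold and conclusion\<close>

theorem theorem1:
  shows "\<forall>w::nat. w \<ge> 1 \<longrightarrow>
    (\<exists>m0::nat. \<forall>m n::nat. m \<ge> m0 \<longrightarrow> n \<ge> 1 \<longrightarrow>
      card (hamming_ball n w) \<ge> 2 ^ m \<longrightarrow> (\<exists>\<phi>. domination_mapping m n w \<phi>))"
proof (intro allI impI)
  fix w :: nat
  assume w: "w \<ge> 1"
  define \<rho> :: real where "\<rho> = 1 - 1 / 2 ^ w"
  \<comment> \<open>Chosen so that \<open>e * m \<le> r\<close> is the premise of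
    \<open>decay\<close> in \<open>card_downset_le\<close>.\<close>
  define e :: real where "e = 1 / (2 ^ (w + 1) * (real w)\<^sup>2)"
  have \<rho>: "0 < \<rho>" "\<rho> < 1" and e: "e > 0" using w by (auto simp: \<rho>_def e_def)
  have "real w > 0" using w by simp
  then have "eventually (\<lambda>m::nat. (real w * real m) ^ w < 2 ^ m) sequentially"
    by real_asymp
  then have "eventually (\<lambda>m::nat. (m * w) ^ w < 2 ^ m) sequentially"
  proof eventually_elim
    case (elim m)
    then have "real ((m * w) ^ w) < real (2 ^ m)"
      by (simp add: mult.commute)
    then show ?case by (simp only: of_nat_less_iff)
  qed
  moreover have "eventually (\<lambda>m::nat. \<forall>r::nat. e * real m \<le> real r \<longrightarrow>
      (4 * real w * real m) ^ w * \<rho> ^ r \<le> 1) sequentially"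
    using w e \<rho> by (intro eventually_power_times_small_power_le_1) auto
  moreover have "eventually (\<lambda>m::nat. 1 \<le> m) sequentially"
    by (rule eventually_ge_at_top)
  ultimately have "eventually (\<lambda>m::nat. (m * w) ^ w < 2 ^ m \<and> 1 \<le> m \<and> (\<forall>r::nat. e * real m \<le> real r \<longrightarrow>
      (4 * real w * real m) ^ w * \<rho> ^ r \<le> 1)) sequentially"
    by eventually_elim auto
  then obtain m0 where m0: "\<And>m. m \<ge> m0 \<Longrightarrow> (m * w) ^ w < 2 ^ m" "\<And>m. m \<ge> m0 \<Longrightarrow> 1 \<le> m"
    "\<And>m r. m \<ge> m0 \<Longrightarrow> e * real m \<le> real r \<Longrightarrow> (4 * real w * real m) ^ w * \<rho> ^ r \<le> 1"
    unfolding eventually_sequentially by blast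
  show "\<exists>m0::nat. \<forall>m n::nat. m \<ge> m0 \<longrightarrow> n \<ge> 1 \<longrightarrow>
      card (hamming_ball n w) \<ge> 2 ^ m \<longrightarrow> (\<exists>\<phi>. domination_mapping m n w \<phi>)"
  proof (intro exI[of _ m0] allI impI)
    fix m n :: nat
    assume m: "m \<ge> m0" and "n \<ge> 1" and ball: "card (hamming_ball n w) \<ge> 2 ^ m"
    let ?P = "{1..n}" and ?V = "{1..m}"
    let ?B = "small_subsets ?P w"
    define c where "c j = Suc (j mod m)" for j
    have "m \<ge> 1" using m by (rule m0)
    then have c: "c \<in> ?P \<rightarrow> ?V" by (auto simp: c_def Suc_le_eq)
    have total: "2 ^ m \<le> card ?B" using ball card_hamming_ball_le[of n w] by linarith
    \<comment> \<open>The ball has at most \<open>(n + 1) ^ w\<close> elements, so its size forces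
      \<open>n \<ge> m * w\<close>; every colour class then has at least \<open>w\<close>
      elements.\<close>
    have "(m * w) ^ w < (n + 1) ^ w"
      using m0(1)[OF m] total card_small_subsets_le[of ?P w] by simp
    then have "m * w < n + 1" by (rule power_less_imp_less_base) simp
    then have wq: "w \<le> n div m"
      using \<open>m \<ge> 1\<close> by (simp add: less_eq_div_iff_mult_less_eq mult.commute)
    \<comment> \<open>As \<open>m * (n div m)\<close> is at least \<open>m\<close>, rounding costs
      at most a factor of two, enough for the constants 2 and 4 in the balance hypotheses.\<close>
    have q: "n < m * (n div m) + m" "m * (n div m) \<le> n" "m \<le> m * (n div m)"
      using \<open>m \<ge> 1\<close> wq w mult_div_mod_eq[of m n] mod_less_divisor[of m n] by (simp, linarith, simp_all)
    have "{j \<in> ?P. j mod m = i - 1} = ?P \<inter> c -` {i}" if "i \<in> ?V" for i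
      using that by (auto simp: c_def)
    then have sizes: "n div m \<le> card (?P \<inter> c -` {i})" "card (?P \<inter> c -` {i}) \<le> n div m + 1"
      if "i \<in> ?V" for i
      using card_residue_class[of "i - 1" m n] that by auto
    have downset: "card F \<le> card {Y \<in> ?B. c ` Y \<in> F}"
      if F: "F \<subseteq> Pow ?V" "\<And>S T. S \<in> F \<Longrightarrow> T \<subseteq> S \<Longrightarrow> T \<in> F" for F
    proof (rule card_downset_le[OF _ _ c w _ _ _ _ _ F])
      show "2 ^ card ?V \<le> card ?B" using total by simp
      fix i assume i: "i \<in> ?V"
      have "m * card (?P \<inter> c -` {i}) \<le> m * (n div m + 1)"
        using sizes(2)[OF i] by (rule mult_le_mono2)
      also have "\<dots> \<le> 2 * n"
        using q(2,3) unfolding distrib_left by linarith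
      finally show "card ?V * card (?P \<inter> c -` {i}) \<le> 2 * card ?P"
        by simp
      have "m * (n div m) \<le> m * card (?P \<inter> c -` {i})"
        using sizes(1)[OF i] by (rule mult_le_mono2)
      then have "n + 1 \<le> 4 * (m * card (?P \<inter> c -` {i}))"
        using q by linarith
      then show "card ?P + 1 \<le> 4 * card ?V * card (?P \<inter> c -` {i})"
        by (simp add: mult.assoc)
      show "w \<le> card (?P \<inter> c -` {i})"
        using sizes(1)[OF i] wq by simp
    next
      fix r :: nat assume "card ?V \<le> 2 ^ (w + 1) * w\<^sup>2 * r"
      then have "real m \<le> real (2 ^ (w + 1) * w\<^sup>2 * r)"
        by (intro of_nat_mono) simp
      then have "e * real m \<le> real r"
        using w by (simp add: e_def field_simps)
      then show "(4 * real w * real (card ?V)) ^ w * (1 - 1 / 2 ^ w) ^ r \<le> 1"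
        using m0(3)[OF m] by (simp add: \<rho>_def)
    qed auto
    have "\<exists>f. inj_on f (Pow ?V) \<and> (\<forall>S\<in>Pow ?V. f S \<in> {Y \<in> ?B. c ` Y \<subseteq> S})"
    proof (rule hall_marriage)
      show "finite {Y \<in> ?B. c ` Y \<subseteq> S}" for S
        using finite_small_subsets[of ?P w] by simp
      fix J assume J: "J \<subseteq> Pow ?V"
      \<comment> \<open>Passing to the down-closure enlarges \<open>J\<close> but leaves the union
        of its Hall sets unchanged, so the bound for down-sets is enough.\<close>
      define F where "F = {T. \<exists>S\<in>J. T \<subseteq> S}"
      have "finite F"
        by (rule finite_subset[of _ "Pow ?V"]) (use J in \<open>auto simp: F_def\<close>)
      then have "card J \<le> card F"
        by (rule card_mono) (auto simp: F_def)
      also have "\<dots> \<le> card {Y \<in> ?B. c ` Y \<in> F}"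
      proof (rule downset)
        show "F \<subseteq> Pow ?V" using J unfolding F_def by blast
        show "T \<in> F" if "S \<in> F" "T \<subseteq> S" for S T using that unfolding F_def by blast
      qed
      also have "{Y \<in> ?B. c ` Y \<in> F} = (\<Union>S\<in>J. {Y \<in> ?B. c ` Y \<subseteq> S})"
        unfolding F_def by blast
      finally show "card J \<le> card (\<Union>S\<in>J. {Y \<in> ?B. c ` Y \<subseteq> S})" .
    qed simp
    then obtain f where "inj_on f (Pow ?V)" "\<And>S. S \<subseteq> ?V \<Longrightarrow> f S \<in> ?B \<and> c ` f S \<subseteq> S"
      by auto
    then show "\<exists>\<phi>. domination_mapping m n w \<phi>"
      by (rule domination_mapping_of_subset_map[OF c])
  qed
qed

end
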